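(* Let $\ell>0$, $Pr>0$ and $\gamma>0$ be fixed, and for $\beta>0$ and $Ra>0$ consider the compressible Lorenz system $\mathcal{L}(\beta,Ra)$ (written out in the context) for the unknowns $(A(t),B(t),C(t))$. Put $$Ra^*_\beta=\frac{\ell^2}{\beta^2+4\pi^2}\,\frac{e^\beta-1}{\beta}\left(\left(\pi^2+\frac{4\pi^2}{\ell^2}+\frac{\beta^2}{4}\right)^2+\beta^2\frac{4\pi^2}{\ell^2}+\gamma\beta^2\frac{4\pi^2}{\ell^2}\right)\left(\pi^2+\frac{4\pi^2}{\ell^2}-\frac{\beta^2}{4}\right),$$ $$Ra^*=\frac{\ell^2}{4\pi^2}\left(\pi^2+\frac{4\pi^2}{\ell^2}\right)^3 .$$ Then there is $\beta_0>0$ such that for every $\beta\in(0,\beta_0)$: (1) $Ra^*_\beta$ is the critical value of $Ra$ for the rest state $(A,B,C)=(0,0,0)$ of $\mathcal{L}(\beta,Ra)$: the rest state is asymptotically stable if $0<Ra<Ra^*_\beta$ and unstable if $Ra>Ra^*_\beta$; (2) $Ra^*_\beta>Ra^*$, and in particular $Ra^*_\beta>\frac{27\pi^4}{4}$. Moreover, to first order in $\beta$, as $\beta\to0^+$, $$Ra^*_\beta=Ra^*\left(1+\frac{\beta}{2}\right)+O(\beta^2).$$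
   Context: Here $\beta$ is the non-dimensional compressibility factor, $Pr$ the Prandtl number, $Ra$ the Rayleigh number, $\ell$ the horizontal period, and $\gamma$ a viscosity constant. Set $\mu=\pi^2+\frac{4\pi^2}{\ell^2}+\frac{\beta^2}{4}$. The compressible Lorenz system $\mathcal{L}(\beta,Ra)$ is the autonomous system $$\dot A=e_1A+e_2B,\qquad \dot B=e_3AC+e_4B+e_5A,\qquad \dot C=e_6AB+e_7C,$$ with coefficients $$e_1=-\frac{4\pi^2Pr}{\mu(\beta^2+4\pi^2)}\left(\mu^2+\beta^2\frac{4\pi^2}{\ell^2}+\gamma\beta^2\frac{4\pi^2}{\ell^2}\right)\frac{e^\beta-1}{\beta},\qquad e_2=\frac{2\pi Pr\sqrt{Ra}}{\mu\,\ell},$$ $$e_3=\sqrt{\frac{2}{\ell}}\,\frac{\beta^2+4\pi^2}{\beta^2+64\pi^2}\,\frac{64\pi^2}{1+e^{-\beta/2}}\,\frac1\ell,$$ $$e_4=-\frac{\beta^2+4\pi^2}{4\pi^2}\,\frac{\beta}{1-e^{-\beta}}\left(\pi^2+\frac{4\pi^2}{\ell^2}-\frac{\beta^2}{4}\right),\qquad e_5=\sqrt{Ra}\,\frac{\beta^2+4\pi^2}{2\pi\ell}\,\frac{\beta}{1-e^{-\beta}},$$ $$e_6=\sqrt{\frac2\ell}\,\frac{\beta^2+16\pi^2}{8\ell}\,\frac{2}{1+e^{-\beta/2}}\left(\frac{4\beta^2}{\beta^2+16\pi^2}-\frac{3\beta^2}{\beta^2+64\pi^2}-1\right),$$ $$e_7=\frac{\beta^2+16\pi^2}{8\pi^2}\,\frac{\beta}{1-e^{-\beta}}\left(\frac{\beta^2}{8}-2\pi^2\right).$$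 Stability, asymptotic stability and instability of the equilibrium $(0,0,0)$ are meant in the usual (Lyapunov) sense. The value $Ra^*$ is the critical value of the classical incompressible case ($\beta=0$) with the same period $\ell$. *)

theory Defs
  imports "HOL-Analysis.Analysis" "HOL-Library.Landau_Symbols"
begin

section \<open>Lyapunov stability for autonomous systems\<close>

definition solves :: "('a::real_normed_vector \<Rightarrow> 'a) \<Rightarrow> (real \<Rightarrow> 'a) \<Rightarrow> real set \<Rightarrow> bool" where
  "solves f x J \<longleftrightarrow> (\<forall>t\<in>J. (x has_vector_derivative f (x t)) (at t within J))"

text \<open>
  Solutions starting close enough to \<open>p\<close> exist for all \<open>t \<ge> 0\<close> and remain close to \<open>p\<close>.
  The second conjunct also ranges over solutions that are only known on a bounded interval, so
  that it does not presuppose that a solution can be continued or is unique.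
\<close>

definition lyapunov_stable :: "('a::real_normed_vector \<Rightarrow> 'a) \<Rightarrow> 'a \<Rightarrow> bool" where
  "lyapunov_stable f p \<longleftrightarrow>
    (\<forall>\<epsilon>>0. \<exists>\<delta>>0. \<forall>x0. dist x0 p < \<delta> \<longrightarrow>
      (\<exists>x. solves f x {0..} \<and> x 0 = x0) \<and>
      (\<forall>x T. solves f x {0..T} \<and> x 0 = x0 \<longrightarrow> (\<forall>t\<in>{0..T}. dist (x t) p < \<epsilon>)))"

definition asymptotically_stable :: "('a::real_normed_vector \<Rightarrow> 'a) \<Rightarrow> 'a \<Rightarrow> bool" where
  "asymptotically_stable f p \<longleftrightarrow>
    lyapunov_stable f p \<and>
    (\<exists>\<delta>>0. \<forall>x. solves f x {0..} \<and> dist (x 0) p < \<delta> \<longrightarrow> (x \<longlongrightarrow> p) at_top)"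

definition unstable :: "('a::real_normed_vector \<Rightarrow> 'a) \<Rightarrow> 'a \<Rightarrow> bool" where
  "unstable f p \<longleftrightarrow> \<not> lyapunov_stable f p"

section \<open>The compressible Lorenz system\<close>

definition lorenz_mu :: "real \<Rightarrow> real \<Rightarrow> real" where
  "lorenz_mu l \<beta> = pi^2 + 4 * pi^2 / l^2 + \<beta>^2 / 4"

definition lorenz_e1 :: "real \<Rightarrow> real \<Rightarrow> real \<Rightarrow> real \<Rightarrow> real" where
  "lorenz_e1 l Pr \<gamma> \<beta> =
    - (4 * pi^2 * Pr / (lorenz_mu l \<beta> * (\<beta>^2 + 4 * pi^2)))
    * ((lorenz_mu l \<beta>)^2 + \<beta>^2 * (4 * pi^2 / l^2) + \<gamma> * \<beta>^2 * (4 * pi^2 / l^2))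
    * ((exp \<beta> - 1) / \<beta>)"

definition lorenz_e2 :: "real \<Rightarrow> real \<Rightarrow> real \<Rightarrow> real \<Rightarrow> real" where
  "lorenz_e2 l Pr \<beta> Ra = 2 * pi * Pr * sqrt Ra / (lorenz_mu l \<beta> * l)"

definition lorenz_e3 :: "real \<Rightarrow> real \<Rightarrow> real" where
  "lorenz_e3 l \<beta> =
    sqrt (2 / l) * ((\<beta>^2 + 4 * pi^2) / (\<beta>^2 + 64 * pi^2))
    * (64 * pi^2 / (1 + exp (- \<beta> / 2))) * (1 / l)"

definition lorenz_e4 :: "real \<Rightarrow> real \<Rightarrow> real" where
  "lorenz_e4 l \<beta> =
    - ((\<beta>^2 + 4 * pi^2) / (4 * pi^2)) * (\<beta> / (1 - exp (- \<beta>)))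
    * (pi^2 + 4 * pi^2 / l^2 - \<beta>^2 / 4)"

definition lorenz_e5 :: "real \<Rightarrow> real \<Rightarrow> real \<Rightarrow> real" where
  "lorenz_e5 l \<beta> Ra =
    sqrt Ra * ((\<beta>^2 + 4 * pi^2) / (2 * pi * l)) * (\<beta> / (1 - exp (- \<beta>)))"

definition lorenz_e6 :: "real \<Rightarrow> real \<Rightarrow> real" where
  "lorenz_e6 l \<beta> =
    sqrt (2 / l) * ((\<beta>^2 + 16 * pi^2) / (8 * l)) * (2 / (1 + exp (- \<beta> / 2)))
    * (4 * \<beta>^2 / (\<beta>^2 + 16 * pi^2) - 3 * \<beta>^2 / (\<beta>^2 + 64 * pi^2) - 1)"

definition lorenz_e7 :: "real \<Rightarrow> real" where
  "lorenz_e7 \<beta> =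
    ((\<beta>^2 + 16 * pi^2) / (8 * pi^2)) * (\<beta> / (1 - exp (- \<beta>))) * (\<beta>^2 / 8 - 2 * pi^2)"

definition lorenz_field ::
  "real \<Rightarrow> real \<Rightarrow> real \<Rightarrow> real \<Rightarrow> real \<Rightarrow> real \<times> real \<times> real \<Rightarrow> real \<times> real \<times> real" where
  "lorenz_field l Pr \<gamma> \<beta> Ra = (\<lambda>(A, B, C).
    (lorenz_e1 l Pr \<gamma> \<beta> * A + lorenz_e2 l Pr \<beta> Ra * B,
     lorenz_e3 l \<beta> * A * C + lorenz_e4 l \<beta> * B + lorenz_e5 l \<beta> Ra * A,
     lorenz_e6 l \<beta> * A * B + lorenz_e7 \<beta> * C))"

definition Ra_crit :: "real \<Rightarrow> real \<Rightarrow> real \<Rightarrow> real" where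
  "Ra_crit l \<gamma> \<beta> =
    l^2 / (\<beta>^2 + 4 * pi^2) * ((exp \<beta> - 1) / \<beta>)
    * ((pi^2 + 4 * pi^2 / l^2 + \<beta>^2 / 4)^2
        + \<beta>^2 * (4 * pi^2 / l^2) + \<gamma> * \<beta>^2 * (4 * pi^2 / l^2))
    * (pi^2 + 4 * pi^2 / l^2 - \<beta>^2 / 4)"

definition Ra_crit_classical :: "real \<Rightarrow> real" where
  "Ra_crit_classical l = l^2 / (4 * pi^2) * (pi^2 + 4 * pi^2 / l^2)^3"

end

theory Submission
  imports Defs "HOL-Real_Asymp.Real_Asymp"
begin

text \<open>
  Write \<open>a = - e1\<close>, \<open>b = e2\<close>, \<open>d = - e4\<close>, \<open>e = e5\<close>, \<open>k = - e7\<close>. For \<open>0 < \<beta> < 1\<close> these numbers are positive,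
  \<open>e3 > 0\<close> and \<open>e6 < 0\<close>. The linearisation at the rest state splits into the damping of \<open>C\<close> and a
  two by two block in \<open>(A, B)\<close> with negative trace and determinant \<open>a * d - b * e\<close>; this
  determinant is a positive multiple of \<open>Ra_crit - Ra\<close> (\<open>lorenz_determinant\<close>), so its sign changes
  exactly at the critical value. Both sides of the threshold are settled by explicit quadratic
  functions, which replace eigenvectors and the principle of linearised stability.

  If \<open>a * d > b * e\<close>, take \<open>V = e A\<^sup>2 + b B\<^sup>2 + w C\<^sup>2\<close>. The weights \<open>e\<close> and \<open>b\<close> symmetrise the linear
  block, and \<open>w\<close> is chosen so that the cubic terms of the derivative of \<open>V\<close> along the flow cancel; such a
  positive \<open>w\<close> exists because \<open>e3\<close> and \<open>e6\<close> have opposite signs. Hence \<open>V\<close> decays exponentially along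
  every solution (\<open>lorenz_type_asymptotically_stable\<close>). Stability includes the existence of
  solutions for all positive times. It follows from a global existence theorem for Lipschitz
  fields, applied to the field precomposed with the projection onto a ball that solutions cannot
  leave (\<open>a_priori_bound_imp_global_solution\<close>).

  If \<open>a * d < b * e\<close>, the symmetrised linear block is the gradient of an indefinite form. Subtracting
  \<open>C\<^sup>2\<close> from that form gives a function that takes positive values arbitrarily close to the origin and
  whose derivative along the flow is positive definite near it. It therefore grows
  exponentially along solutions that start where it is positive, and these cannot stay
  near the origin (\<open>lorenz_type_unstable\<close>).

  For the size of the critical value, \<open>Ra_crit\<close> is the product of \<open>(exp \<beta> - 1) / \<beta> = 1 + \<beta> / 2 + O(\<beta>\<^sup>2)\<close> and
  of a smooth function of \<open>\<beta>\<^sup>2\<close> whose value at \<open>0\<close> is \<open>Ra_crit_classical\<close>. This gives the expansion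
  (\<open>Ra_crit_expansion\<close>), and the positive first-order term gives the strict inequality for small
  \<open>\<beta>\<close>. The bound \<open>27 * pi^4 / 4\<close> is the minimum of \<open>Ra_crit_classical\<close> over all periods.
\<close>

section \<open>Global solutions of ordinary differential equations\<close>

lemma solves_subset: "solves f x J \<Longrightarrow> I \<subseteq> J \<Longrightarrow> solves f x I"
  unfolding solves_def by (blast intro: has_vector_derivative_within_subset)

lemma solves_imp_continuous_on: "solves f x J \<Longrightarrow> continuous_on J x"
  unfolding solves_def continuous_on_eq_continuous_within
  by (blast intro: has_vector_derivative_continuous)

lemma norm_integral_le_exp:
  fixes h :: "real \<Rightarrow> 'a::banach"
  assumes cont: "continuous_on {0..t} h" and k: "k > 0" and t: "0 \<le> t" and M: "0 \<le> M"
    and bound: "\<And>s. s \<in> {0..t} \<Longrightarrow> norm (h s) \<le> M * exp (k * s)"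
  shows "norm (integral {0..t} h) \<le> M / k * exp (k * t)"
proof -
  have "((\<lambda>s. M * exp (k * s)) has_integral (M / k * exp (k * t) - M / k * exp (k * 0))) {0..t}"
    using k t by (intro fundamental_theorem_of_calculus)
      (auto intro!: derivative_eq_intros simp flip: has_real_derivative_iff_has_vector_derivative)
  then have "norm (integral {0..t} h) \<le> M / k * exp (k * t) - M / k * exp (k * 0)"
    using integral_norm_bound_integral[of h "{0..t}" "\<lambda>s. M * exp (k * s)"] cont bound
    by (simp add: integrable_continuous_real has_integral_iff)
  also have "\<dots> \<le> M / k * exp (k * t)"
    using M k by simp
  finally show ?thesis .
qed

lemma integral_has_vector_derivative_atLeast:
  fixes h :: "real \<Rightarrow> 'a::banach"
  assumes "continuous_on UNIV h" and "a \<le> t"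
  shows "((\<lambda>t. integral {a..t} h) has_vector_derivative h t) (at t within {a..})"
proof -
  have "((\<lambda>t. integral {a..t} h) has_vector_derivative h t) (at t within {a..t+1})"
    using assms by (intro integral_has_vector_derivative) (auto intro: continuous_on_subset)
  moreover have "at t within {a..t+1} = at t within {a..}"
    by (rule at_within_nhd[of t "{..<t+1}"]) auto
  ultimately show ?thesis by simp
qed

text \<open>
  With \<open>x t = exp (k * t) y t\<close>, the integral equation for \<open>x\<close> becomes a fixed point equation for \<open>y\<close>. The
  weight makes the integral operator a contraction of the space of bounded continuous functions
  as soon as \<open>k > L\<close>, so the whole half-line is covered at once and no local solutions have to be
  glued together.
\<close>

lemma lipschitz_imp_global_solution:
  fixes g :: "'a::banach \<Rightarrow> 'a"
  assumes lip: "L-lipschitz_on UNIV g"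
  shows "\<exists>x. solves g x {0..} \<and> x 0 = x0"
proof -
  define k where "k = L + 1"
  have L: "L \<ge> 0" and k: "k \<ge> 1" "k > 0"
    using lipschitz_on_nonneg[OF lip] by (auto simp: k_def)
  have contg: "continuous_on S g" for S
    using lipschitz_on_continuous_on[OF lip] continuous_on_subset by blast
  have contw: "continuous_on S (\<lambda>s. g (exp (k * s) *\<^sub>R apply_bcontfun y s))" for S y
    by (rule continuous_on_compose2[OF contg[of UNIV]]) (auto intro!: continuous_intros)
  \<comment> \<open>The maximum extends the operator constantly to negative times, because bounded continuous
    functions are defined on all reals.\<close>
  define \<Phi> where "\<Phi> y t = exp (- k * max t 0) *\<^sub>R
      (x0 + integral {0..max t 0} (\<lambda>s. g (exp (k * s) *\<^sub>R apply_bcontfun y s)))" for y t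
  have \<Phi>_bcontfun: "\<Phi> y \<in> bcontfun" for y
  proof -
    have *: "continuous_on {0..} (\<lambda>t. integral {0..t} (\<lambda>s. g (exp (k * s) *\<^sub>R apply_bcontfun y s)))"
      unfolding continuous_on_eq_continuous_within
      by (intro ballI has_vector_derivative_continuous[OF integral_has_vector_derivative_atLeast] contw) auto
    have "continuous_on UNIV (\<Phi> y)"
      unfolding \<Phi>_def
      by (intro continuous_intros continuous_on_compose2[OF *]) auto
    moreover
    obtain N where N: "\<And>s. norm (apply_bcontfun y s) \<le> N"
      using bounded_apply_bcontfun[of y] by (auto simp: bounded_iff)
    then have N0: "N \<ge> 0" using norm_ge_zero order_trans by blast
    define M where "M = norm (g 0) + L * N"
    have M0: "M \<ge> 0" using L N0 by (simp add: M_def)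
    have "norm (\<Phi> y t) \<le> norm x0 + M" for t
    proof -
      let ?t = "max t 0"
      have "norm (g (exp (k * s) *\<^sub>R apply_bcontfun y s)) \<le> M * exp (k * s)" if "s \<in> {0..?t}" for s
      proof -
        have e: "exp (k * s) \<ge> 1" using that k by simp
        have "norm (g (exp (k * s) *\<^sub>R apply_bcontfun y s))
            \<le> norm (g 0) + dist (g (exp (k * s) *\<^sub>R apply_bcontfun y s)) (g 0)"
          by (metis dist_norm add.commute diff_add_cancel norm_triangle_ineq)
        also have "\<dots> \<le> norm (g 0) + L * (exp (k * s) * N)"
          using lipschitz_onD[OF lip, of "exp (k * s) *\<^sub>R apply_bcontfun y s" 0] N[of s] L
          by (auto intro!: order_trans[OF lipschitz_onD[OF lip]] mult_left_mono)
        also have "\<dots> \<le> norm (g 0) * exp (k * s) + L * (exp (k * s) * N)"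
          using e mult_left_mono[OF e norm_ge_zero[of "g 0"]] by simp
        finally show ?thesis by (simp add: M_def algebra_simps)
      qed
      then have "norm (integral {0..?t} (\<lambda>s. g (exp (k * s) *\<^sub>R apply_bcontfun y s))) \<le> M / k * exp (k * ?t)"
        by (intro norm_integral_le_exp contw k M0) auto
      also have "\<dots> \<le> M * exp (k * ?t)"
        using M0 k by (intro mult_right_mono) (auto simp: divide_le_eq mult_le_cancel_left1)
      finally have "norm (\<Phi> y t) \<le> exp (- k * ?t) * (norm x0 + M * exp (k * ?t))"
        unfolding \<Phi>_def by (auto intro!: mult_left_mono norm_triangle_le)
      also have "\<dots> = exp (- k * ?t) * norm x0 + M"
        by (simp add: algebra_simps flip: exp_add)
      also have "\<dots> \<le> norm x0 + M"
        using k by (auto intro!: mult_left_le_one_le)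
      finally show ?thesis .
    qed
    ultimately show ?thesis
      unfolding bcontfun_def bounded_iff by auto
  qed
  have \<Phi>_contraction: "dist (Bcontfun (\<Phi> y)) (Bcontfun (\<Phi> z)) \<le> L / k * dist y z" for y z
  proof (rule dist_bound)
    fix t :: real
    let ?t = "max t 0"
    let ?I = "\<lambda>y. integral {0..?t} (\<lambda>s. g (exp (k * s) *\<^sub>R apply_bcontfun y s))"
    have "norm (g (exp (k * s) *\<^sub>R apply_bcontfun y s) - g (exp (k * s) *\<^sub>R apply_bcontfun z s))
        \<le> (L * dist y z) * exp (k * s)" for s
    proof -
      have "norm (g (exp (k * s) *\<^sub>R apply_bcontfun y s) - g (exp (k * s) *\<^sub>R apply_bcontfun z s))
        \<le> L * dist (exp (k * s) *\<^sub>R apply_bcontfun y s) (exp (k * s) *\<^sub>R apply_bcontfun z s)"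
        using lipschitz_onD[OF lip] by (simp add: dist_norm)
      also have "\<dots> = L * (exp (k * s) * dist (apply_bcontfun y s) (apply_bcontfun z s))"
        by (simp add: dist_norm flip: scaleR_diff_right)
      also have "\<dots> \<le> L * (exp (k * s) * dist y z)"
        using L by (intro mult_left_mono dist_bounded) auto
      finally show ?thesis by (simp add: algebra_simps)
    qed
    then have "norm (integral {0..?t} (\<lambda>s. g (exp (k * s) *\<^sub>R apply_bcontfun y s)
         - g (exp (k * s) *\<^sub>R apply_bcontfun z s))) \<le> (L * dist y z) / k * exp (k * ?t)"
      using L by (intro norm_integral_le_exp continuous_on_diff contw k) auto
    then have "norm (?I y - ?I z) \<le> (L * dist y z) / k * exp (k * ?t)"
      by (subst (asm) integral_diff) (auto intro!: integrable_continuous_real contw)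
    then have "exp (- k * ?t) * norm (?I y - ?I z) \<le> exp (- k * ?t) * ((L * dist y z) / k * exp (k * ?t))"
      by (intro mult_left_mono) auto
    also have "\<dots> = L / k * dist y z"
      by (simp add: algebra_simps flip: exp_add)
    finally show "dist (apply_bcontfun (Bcontfun (\<Phi> y)) t) (apply_bcontfun (Bcontfun (\<Phi> z)) t) \<le> L / k * dist y z"
      by (simp add: Bcontfun_inverse \<Phi>_bcontfun dist_norm \<Phi>_def flip: scaleR_diff_right)
  qed
  obtain y where "Bcontfun (\<Phi> y) = y"
    using banach_fix_type[of "L / k" "\<lambda>y. Bcontfun (\<Phi> y)"] \<Phi>_contraction L k
    by (auto simp: k_def)
  then have y: "apply_bcontfun y = \<Phi> y"
    using Bcontfun_inverse[OF \<Phi>_bcontfun[of y]] by simp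
  define x where "x t = exp (k * t) *\<^sub>R apply_bcontfun y t" for t
  have x: "x t = x0 + integral {0..t} (\<lambda>s. g (x s))" if "t \<ge> 0" for t
    using that unfolding x_def by (subst y) (simp add: \<Phi>_def flip: exp_add)
  have contx: "continuous_on S (\<lambda>s. g (x s))" for S
    unfolding x_def by (rule contw)
  have "(x has_vector_derivative g (x t)) (at t within {0..})" if "t \<ge> 0" for t
  proof -
    have "((\<lambda>t. x0 + integral {0..t} (\<lambda>s. g (x s))) has_vector_derivative 0 + g (x t)) (at t within {0..})"
      using that by (intro has_vector_derivative_add has_vector_derivative_const
          integral_has_vector_derivative_atLeast contx)
    then have "((\<lambda>t. x0 + integral {0..t} (\<lambda>s. g (x s))) has_vector_derivative g (x t)) (at t within {0..})"
      by simp
    then show ?thesis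
      by (rule has_vector_derivative_transform[rotated 2]) (use that x in auto)
  qed
  moreover have "x 0 = x0" using x[of 0] by simp
  ultimately show ?thesis unfolding solves_def by auto
qed

text \<open>
  Composing \<open>f\<close> with the nearest-point projection onto the ball yields a globally Lipschitz field
  that agrees with \<open>f\<close> on the ball. Up to its first exit time a solution of the modified equation
  solves the original one, so the a priori bound rules out that it ever reaches the boundary.
\<close>

lemma a_priori_bound_imp_global_solution:
  fixes f :: "'a::euclidean_space \<Rightarrow> 'a"
  assumes lip: "L-lipschitz_on (cball p R) f" and x0: "dist x0 p < R"
    and bound: "\<And>x T. solves f x {0..T} \<Longrightarrow> x 0 = x0 \<Longrightarrow> 0 \<le> T \<Longrightarrow> dist (x T) p < R"
  shows "\<exists>x. solves f x {0..} \<and> x 0 = x0"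
proof -
  have R: "R > 0"
    using x0 zero_le_dist[of x0 p] by linarith
  define P where "P = closest_point (cball p R)"
  have P_in: "P z \<in> cball p R" for z
    using R unfolding P_def by (intro closest_point_in_set) auto
  have P_id: "P z = z" if "z \<in> cball p R" for z
    using that unfolding P_def by (rule closest_point_self)
  have "L-lipschitz_on UNIV (\<lambda>z. f (P z))"
  proof (rule lipschitz_onI)
    fix z w
    have "dist (f (P z)) (f (P w)) \<le> L * dist (P z) (P w)"
      using lipschitz_onD[OF lip P_in P_in] .
    also have "\<dots> \<le> L * dist z w"
      using R lipschitz_on_nonneg[OF lip] unfolding P_def
      by (intro mult_left_mono closest_point_lipschitz) auto
    finally show "dist (f (P z)) (f (P w)) \<le> L * dist z w" .
  qed (rule lipschitz_on_nonneg[OF lip])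
  from lipschitz_imp_global_solution[OF this] obtain x
    where x: "solves (\<lambda>z. f (P z)) x {0..}" "x 0 = x0" by blast
  have loc: "solves f x S" if "S \<subseteq> {0..}" "\<And>t. t \<in> S \<Longrightarrow> dist (x t) p \<le> R" for S
  proof -
    have "solves (\<lambda>z. f (P z)) x S" by (rule solves_subset[OF x(1) that(1)])
    then show ?thesis using that(2) P_id by (auto simp: solves_def dist_commute)
  qed
  have "dist (x t) p < R" if "t \<ge> 0" for t
  proof (rule ccontr)
    assume t: "\<not> dist (x t) p < R"
    define E where "E = {s \<in> {0..}. R \<le> dist (x s) p}"
    have contd: "continuous_on {0..} (\<lambda>s. dist (x s) p)"
      by (intro continuous_intros solves_imp_continuous_on[OF x(1)])
    have "closed ({0..} \<inter> (\<lambda>s. dist (x s) p) -` {R..})"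
      by (intro continuous_closed_preimage contd) auto
    also have "{0..} \<inter> (\<lambda>s. dist (x s) p) -` {R..} = E"
      by (auto simp: E_def)
    finally have "closed E" .
    moreover have "E \<noteq> {}" "bdd_below E"
      using t that by (auto simp: E_def intro!: bdd_belowI[of _ 0])
    ultimately have exit: "Inf E \<in> E" by (intro closed_contains_Inf)
    then have "Inf E \<noteq> 0" "Inf E \<ge> 0"
      using x0 x(2) by (auto simp: E_def)
    then have pos: "0 < Inf E" by simp
    have before: "dist (x s) p \<le> R" if "s \<in> {0..<Inf E}" for s
    proof (rule ccontr)
      assume "\<not> dist (x s) p \<le> R"
      then have "s \<in> E" using that by (auto simp: E_def)
      from cInf_lower[OF this \<open>bdd_below E\<close>] that show False by simp
    qed
    have cl: "closure {0..<Inf E} = {0..Inf E}"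
      using pos by (rule closure_atLeastLessThan)
    have "continuous_on (closure {0..<Inf E}) (\<lambda>s. dist (x s) p)"
      unfolding cl by (rule continuous_on_subset[OF contd]) auto
    from continuous_le_on_closure[OF this _ before]
    have "dist (x s) p \<le> R" if "s \<in> {0..Inf E}" for s
      using that unfolding cl by blast
    then have "solves f x {0..Inf E}"
      by (intro loc) auto
    with bound[of x "Inf E"] x(2) exit show False
      by (auto simp: E_def)
  qed
  then show ?thesis using loc[of "{0..}"] x(2) by (auto intro: less_imp_le)
qed

section \<open>Lyapunov's and Chetaev's theorems\<close>

text \<open>
  No sign is required of \<open>k\<close> or of \<open>W\<close>: negative \<open>k\<close> yields decay, and the inequality for \<open>- W\<close> yields
  growth.
\<close>

lemma exponential_differential_inequality:
  fixes W W' :: "real \<Rightarrow> real"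
  assumes deriv: "\<And>t. t \<in> {0..T} \<Longrightarrow> (W has_real_derivative W' t) (at t within {0..T})"
    and le: "\<And>t. t \<in> {0..T} \<Longrightarrow> W' t \<le> k * W t" and T: "0 \<le> T"
  shows "W T \<le> exp (k * T) * W 0"
proof -
  let ?F = "\<lambda>t. exp (- k * t) * W t"
  have F: "(?F has_real_derivative exp (- k * t) * (W' t - k * W t)) (at t within {0..T})"
    if "t \<in> {0..T}" for t
    using that by (auto intro!: derivative_eq_intros deriv simp: algebra_simps)
  have "?F T \<le> ?F 0"
  proof (rule DERIV_nonpos_imp_decreasing_open[OF T])
    fix t assume t: "0 < t" "t < T"
    then have "(?F has_real_derivative exp (- k * t) * (W' t - k * W t)) (at t)"
      using F[of t] by (simp add: at_within_Icc_at)
    moreover have "exp (- k * t) * (W' t - k * W t) \<le> 0"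
      using le[of t] t by (simp add: mult_le_0_iff)
    ultimately show "\<exists>y. DERIV ?F t :> y \<and> y \<le> 0" by blast
  next
    show "continuous_on {0..T} ?F"
      unfolding continuous_on_eq_continuous_within using F DERIV_continuous by blast
  qed
  then have "exp (k * T) * ?F T \<le> exp (k * T) * ?F 0"
    by (intro mult_left_mono) auto
  then show ?thesis by (simp add: mult.assoc[symmetric] flip: exp_add)
qed

lemma solves_exponential_bound:
  fixes V :: "'a::real_normed_vector \<Rightarrow> real"
  assumes x: "solves f x {0..T}" and T: "0 \<le> T"
    and V: "\<And>t. t \<in> {0..T} \<Longrightarrow> (V has_derivative V' (x t)) (at (x t))"
    and le: "\<And>t. t \<in> {0..T} \<Longrightarrow> V' (x t) (f (x t)) \<le> k * V (x t)"
  shows "V (x T) \<le> exp (k * T) * V (x 0)"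
proof (rule exponential_differential_inequality[where W = "\<lambda>t. V (x t)", OF _ le T])
  fix t assume t: "t \<in> {0..T}"
  have "(V \<circ> x has_vector_derivative V' (x t) (f (x t))) (at t within {0..T})"
    using x t by (intro vector_derivative_diff_chain_within has_derivative_at_withinI[OF V])
      (auto simp: solves_def)
  then show "((\<lambda>t. V (x t)) has_real_derivative V' (x t) (f (x t))) (at t within {0..T})"
    by (simp add: has_real_derivative_iff_has_vector_derivative o_def)
qed

text \<open>
  Decay is required on the whole space, so that it can be integrated along a solution before
  knowing where the solution stays. The resulting bound on \<open>V\<close> confines solutions to a ball, which
  at the same time supplies the a priori bound for global existence.
\<close>

theorem lyapunov_function_imp_asymptotically_stable:
  fixes f :: "'a::euclidean_space \<Rightarrow> 'a"
  assumes lip: "\<And>R. \<exists>L. L-lipschitz_on (cball p R) f"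
    and V: "\<And>z. (V has_derivative V' z) (at z)"
    and decay: "\<And>z. V' z (f z) \<le> - c * V z" and c: "c > 0"
    and coercive: "\<And>z. m * (dist z p)^2 \<le> V z" and m: "m > 0" and Vp: "V p = 0"
  shows "asymptotically_stable f p"
proof -
  have bound: "m * (dist (x T) p)^2 \<le> exp (- c * T) * V (x 0)"
    if "solves f x {0..T}" "0 \<le> T" for x T
    using solves_exponential_bound[OF that V decay] coercive[of "x T"] by linarith
  have Vnn: "V z \<ge> 0" for z
    by (rule order_trans[OF _ coercive]) (use m in simp)
  have "lyapunov_stable f p"
    unfolding lyapunov_stable_def
  proof (intro allI impI)
    fix \<epsilon> :: real assume \<epsilon>: "\<epsilon> > 0"
    then have "m * \<epsilon>^2 > 0" using m by simp
    moreover have "isCont V p"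
      using V has_derivative_continuous by blast
    ultimately obtain \<delta> where "\<delta> > 0" "\<And>z. dist z p < \<delta> \<Longrightarrow> dist (V z) (V p) < m * \<epsilon>^2"
      unfolding continuous_at_eps_delta by blast
    then have \<delta>: "\<delta> > 0" "\<And>z. dist z p < \<delta> \<Longrightarrow> V z < m * \<epsilon>^2"
      using Vp Vnn by (auto simp: dist_real_def)
    have near: "dist (x T) p < \<epsilon>"
      if x: "solves f x {0..T}" "0 \<le> T" "dist (x 0) p < \<delta>" for x T
    proof -
      have "m * (dist (x T) p)^2 \<le> exp (- c * T) * V (x 0)"
        by (rule bound[OF x(1,2)])
      also have "\<dots> \<le> V (x 0)"
        using Vnn c x(2) by (intro mult_left_le_one_le) auto
      also have "\<dots> < m * \<epsilon>^2"
        by (rule \<delta>(2)[OF x(3)])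
      finally have "(dist (x T) p)^2 < \<epsilon>^2"
        using m by simp
      then show ?thesis
        by (rule power2_less_imp_less) (use \<epsilon> in simp)
    qed
    show "\<exists>\<delta>>0. \<forall>x0. dist x0 p < \<delta> \<longrightarrow>
      (\<exists>x. solves f x {0..} \<and> x 0 = x0) \<and>
      (\<forall>x T. solves f x {0..T} \<and> x 0 = x0 \<longrightarrow> (\<forall>t\<in>{0..T}. dist (x t) p < \<epsilon>))"
    proof (intro exI[of _ "min \<delta> \<epsilon>"] conjI allI impI ballI)
      fix x0 assume x0: "dist x0 p < min \<delta> \<epsilon>"
      obtain L where "L-lipschitz_on (cball p \<epsilon>) f" using lip by blast
      then show "\<exists>x. solves f x {0..} \<and> x 0 = x0"
        by (rule a_priori_bound_imp_global_solution) (use x0 near in auto)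
    next
      fix x0 x T t
      assume *: "dist x0 p < min \<delta> \<epsilon>" "solves f x {0..T} \<and> x 0 = x0" "t \<in> {0..T}"
      have "solves f x {0..t}"
        by (rule solves_subset[of f x "{0..T}"]) (use * in auto)
      then show "dist (x t) p < \<epsilon>"
        using * by (intro near) auto
    qed (use \<delta> \<epsilon> in auto)
  qed
  moreover have "(x \<longlongrightarrow> p) at_top" if x: "solves f x {0..}" for x
  proof -
    have "((\<lambda>t. exp (- c * t)) \<longlongrightarrow> 0) at_top"
      using c by (intro filterlim_compose[OF exp_at_bot]
        filterlim_tendsto_neg_mult_at_bot[OF tendsto_const _ filterlim_ident]) auto
    then have "((\<lambda>t. V (x 0) / m * exp (- c * t)) \<longlongrightarrow> 0) at_top"
      by (rule tendsto_mult_right_zero)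
    moreover have "\<forall>\<^sub>F t in at_top. norm ((dist (x t) p)^2) \<le> V (x 0) / m * exp (- c * t)"
      using eventually_ge_at_top[of 0]
    proof eventually_elim
      case (elim t)
      have "m * (dist (x t) p)^2 \<le> exp (- c * t) * V (x 0)"
        by (rule bound[OF solves_subset[OF x] elim]) auto
      then show ?case using m by (simp add: field_simps)
    qed
    ultimately have "((\<lambda>t. (dist (x t) p)^2) \<longlongrightarrow> 0) at_top"
      by (rule Lim_null_comparison[rotated])
    then have "((\<lambda>t. dist (x t) p) \<longlongrightarrow> 0) at_top"
      using tendsto_real_sqrt[of "\<lambda>t. (dist (x t) p)^2" 0 at_top] by simp
    then show ?thesis by (rule tendsto_dist_iff[THEN iffD2])
  qed
  ultimately show ?thesis
    unfolding asymptotically_stable_def using zero_less_one by blast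
qed

text \<open>
  If \<open>p\<close> were stable, a solution starting near \<open>p\<close> where \<open>V\<close> is positive would exist forever and
  stay in the ball; but there \<open>V\<close> grows exponentially and is bounded. Since stability itself
  provides the solution, no existence theorem enters.
\<close>

theorem chetaev_function_imp_unstable:
  fixes f :: "'a::real_normed_vector \<Rightarrow> 'a" and V :: "'a \<Rightarrow> real"
  assumes r: "r > 0"
    and V: "\<And>z. dist z p < r \<Longrightarrow> (V has_derivative V' z) (at z)"
    and growth: "\<And>z. dist z p < r \<Longrightarrow> c * V z \<le> V' z (f z)" and c: "c > 0"
    and bounded: "\<And>z. dist z p < r \<Longrightarrow> V z \<le> M"
    and pos: "\<And>\<delta>. \<delta> > 0 \<Longrightarrow> \<exists>z. dist z p < \<delta> \<and> V z > 0"
  shows "unstable f p"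
  unfolding unstable_def
proof
  assume "lyapunov_stable f p"
  with r have "\<exists>\<delta>>0. \<forall>x0. dist x0 p < \<delta> \<longrightarrow>
      (\<exists>x. solves f x {0..} \<and> x 0 = x0) \<and>
      (\<forall>x T. solves f x {0..T} \<and> x 0 = x0 \<longrightarrow> (\<forall>t\<in>{0..T}. dist (x t) p < r))"
    unfolding lyapunov_stable_def by simp
  then obtain \<delta> where \<delta>: "\<delta> > 0" "\<And>x0. dist x0 p < \<delta> \<Longrightarrow>
      (\<exists>x. solves f x {0..} \<and> x 0 = x0) \<and>
      (\<forall>x T. solves f x {0..T} \<and> x 0 = x0 \<longrightarrow> (\<forall>t\<in>{0..T}. dist (x t) p < r))"
    by auto
  obtain x0 where x0: "dist x0 p < \<delta>" "V x0 > 0" using pos \<delta>(1) by blast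
  obtain x where x: "solves f x {0..}" "x 0 = x0" using \<delta>(2)[OF x0(1)] by blast
  have sol: "solves f x {0..T}" for T
    by (rule solves_subset[OF x(1)]) auto
  have inside: "dist (x t) p < r" if "0 \<le> t" for t
    using \<delta>(2)[OF x0(1)] sol[of t] x(2) that by auto
  have lower: "exp (c * T) * V x0 \<le> M" if "0 \<le> T" for T
  proof -
    have "- V (x T) \<le> exp (c * T) * (- V (x 0))"
      using inside growth
      by (intro solves_exponential_bound[where V = "\<lambda>z. - V z" and V' = "\<lambda>z h. - V' z h", OF sol that]
          has_derivative_minus V) auto
    then show ?thesis using bounded[OF inside[OF that]] x(2) by simp
  qed
  have M: "M > 0" using lower[of 0] x0(2) by simp
  \<comment> \<open>At time \<open>M / (c * V x0)\<close> the estimate \<open>1 + y \<le> exp y\<close> already pushes the lower bound above \<open>M\<close>.\<close>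
  have "(1 + M / V x0) * V x0 \<le> exp (c * (M / V x0 / c)) * V x0"
    using x0(2) c exp_ge_add_one_self[of "M / V x0"] by (intro mult_right_mono) auto
  also have "\<dots> \<le> M"
    using x0(2) c M by (intro lower) auto
  finally show False using x0(2) by (simp add: distrib_right)
qed

section \<open>Quadratic systems of Lorenz type\<close>

text \<open>
  The signs are arranged so that, for the compressible Lorenz system at small \<open>\<beta>\<close>, all linear
  parameters are positive; the quadratic couplings \<open>m\<close> and \<open>n\<close> carry their own sign.
\<close>

definition lorenz_type ::
  "real \<Rightarrow> real \<Rightarrow> real \<Rightarrow> real \<Rightarrow> real \<Rightarrow> real \<Rightarrow> real \<Rightarrow> real \<times> real \<times> real \<Rightarrow> real \<times> real \<times> real" where
  "lorenz_type a b d e k m n = (\<lambda>(A, B, C).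
    (- a * A + b * B, e * A - d * B + m * A * C, n * A * B - k * C))"

lemma norm_triple_le: "norm (u, v, w) \<le> \<bar>u\<bar> + \<bar>v\<bar> + \<bar>w\<bar>" for u v w :: real
  using norm_Pair_le[of u "(v, w)"] norm_Pair_le[of v w] by simp

lemma abs_le_norm_triple:
  fixes u v w :: real
  shows "\<bar>u\<bar> \<le> norm (u, v, w)" "\<bar>v\<bar> \<le> norm (u, v, w)" "\<bar>w\<bar> \<le> norm (u, v, w)"
  by (simp_all add: norm_Pair real_le_rsqrt)

lemma norm_triple_power2: "(norm (u, v, w))^2 = u^2 + v^2 + w^2" for u v w :: real
  by (simp add: norm_Pair)

lemma abs_mult_diff_le:
  fixes x y x' y' :: real
  assumes "\<bar>x\<bar> \<le> R" "\<bar>y'\<bar> \<le> R"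
  shows "\<bar>x * y - x' * y'\<bar> \<le> R * (\<bar>x - x'\<bar> + \<bar>y - y'\<bar>)"
proof -
  have "x * y - x' * y' = x * (y - y') + (x - x') * y'" by (simp add: algebra_simps)
  also have "\<bar>\<dots>\<bar> \<le> \<bar>x\<bar> * \<bar>y - y'\<bar> + \<bar>x - x'\<bar> * \<bar>y'\<bar>"
    using abs_triangle_ineq by (metis abs_mult)
  also have "\<dots> \<le> R * \<bar>y - y'\<bar> + \<bar>x - x'\<bar> * R"
    using assms by (intro add_mono mult_mono) auto
  finally show ?thesis by (simp add: algebra_simps)
qed

lemma lorenz_type_lipschitz_on:
  "\<exists>L. L-lipschitz_on (cball 0 R) (lorenz_type a b d e k m n)"
proof (intro exI lipschitz_onI)
  let ?L = "\<bar>a\<bar> + \<bar>b\<bar> + \<bar>e\<bar> + \<bar>d\<bar> + \<bar>m\<bar> * (2 * \<bar>R\<bar>) + \<bar>n\<bar> * (2 * \<bar>R\<bar>) + \<bar>k\<bar>"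
  fix z w :: "real \<times> real \<times> real"
  assume zw: "z \<in> cball 0 R" "w \<in> cball 0 R"
  obtain A B C where z: "z = (A, B, C)" by (cases z)
  obtain A' B' C' where w: "w = (A', B', C')" by (cases w)
  have R: "\<bar>A\<bar> \<le> \<bar>R\<bar>" "\<bar>B'\<bar> \<le> \<bar>R\<bar>" "\<bar>C'\<bar> \<le> \<bar>R\<bar>"
    using zw abs_le_norm_triple(1)[of A B C] abs_le_norm_triple[where u = A' and v = B' and w = C']
    by (auto simp: z w)
  define D where "D = dist z w"
  have D: "\<bar>A - A'\<bar> \<le> D" "\<bar>B - B'\<bar> \<le> D" "\<bar>C - C'\<bar> \<le> D"
    using abs_le_norm_triple[where u = "A - A'" and v = "B - B'" and w = "C - C'"]
    by (auto simp: D_def z w dist_norm)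
  have quad: "\<bar>A * B - A' * B'\<bar> \<le> 2 * \<bar>R\<bar> * D" "\<bar>A * C - A' * C'\<bar> \<le> 2 * \<bar>R\<bar> * D"
  proof -
    have "\<bar>R\<bar> * (\<bar>A - A'\<bar> + \<bar>B - B'\<bar>) \<le> \<bar>R\<bar> * (D + D)" "\<bar>R\<bar> * (\<bar>A - A'\<bar> + \<bar>C - C'\<bar>) \<le> \<bar>R\<bar> * (D + D)"
      using D by (intro mult_left_mono add_mono; simp)+
    moreover have "\<bar>R\<bar> * (D + D) = 2 * \<bar>R\<bar> * D" by simp
    ultimately show "\<bar>A * B - A' * B'\<bar> \<le> 2 * \<bar>R\<bar> * D" "\<bar>A * C - A' * C'\<bar> \<le> 2 * \<bar>R\<bar> * D"
      using abs_mult_diff_le[OF R(1,2), of B A'] abs_mult_diff_le[OF R(1,3), of C A'] by simp_all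
  qed
  have scaled: "\<bar>s * x\<bar> \<le> \<bar>s\<bar> * y" if "\<bar>x\<bar> \<le> y" for s x y :: real
    using that by (simp add: abs_mult mult_left_mono)
  have abs_add_le: "\<bar>x + y\<bar> \<le> s + t" and abs_diff_le: "\<bar>x - y\<bar> \<le> s + t"
    if "\<bar>x\<bar> \<le> s" "\<bar>y\<bar> \<le> t" for x y s t :: real
    using that by linarith+
  have "dist (lorenz_type a b d e k m n z) (lorenz_type a b d e k m n w)
      = norm (b * (B - B') - a * (A - A'),
          e * (A - A') - d * (B - B') + m * (A * C - A' * C'), n * (A * B - A' * B') - k * (C - C'))"
    by (simp add: z w lorenz_type_def dist_norm algebra_simps)
  also have "\<dots> \<le> (\<bar>b\<bar> * D + \<bar>a\<bar> * D) + ((\<bar>e\<bar> * D + \<bar>d\<bar> * D) + \<bar>m\<bar> * (2 * \<bar>R\<bar> * D))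
      + (\<bar>n\<bar> * (2 * \<bar>R\<bar> * D) + \<bar>k\<bar> * D)"
    by (intro order_trans[OF norm_triple_le] add_mono abs_add_le abs_diff_le scaled D quad)
  also have "\<dots> = ?L * D" by (simp add: algebra_simps)
  finally show "dist (lorenz_type a b d e k m n z) (lorenz_type a b d e k m n w) \<le> ?L * dist z w"
    by (simp add: D_def)
qed auto

text \<open>
  Completing the square after multiplication by \<open>p\<close>.
\<close>

lemma two_by_two_form_nonneg:
  fixes p q s :: real
  assumes "p > 0" and "s^2 \<le> p * q"
  shows "0 \<le> p * A^2 - 2 * s * A * B + q * B^2"
proof -
  have "0 \<le> (p * A - s * B)^2 + (p * q - s^2) * B^2"
    using assms(2) by simp
  also have "\<dots> = p * (p * A^2 - 2 * s * A * B + q * B^2)"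
    by (simp add: power2_eq_square algebra_simps)
  finally show ?thesis using assms(1) by (simp add: zero_le_mult_iff)
qed

text \<open>
  Along the flow, \<open>e A\<^sup>2 + b B\<^sup>2 + w C\<^sup>2\<close> has derivative \<open>- 2 (a e A\<^sup>2 - 2 b e A B + b d B\<^sup>2 + k w C\<^sup>2)\<close> plus
  the cubic term \<open>2 (b m + w n) A B C\<close>. The quadratic form is definite precisely when \<open>b e < a d\<close>,
  and the cubic term disappears for \<open>w = - b m / n\<close>.
\<close>

theorem lorenz_type_asymptotically_stable:
  assumes pos: "a > 0" "b > 0" "d > 0" "e > 0" "k > 0" and m: "m > 0" and n: "n < 0"
    and det: "b * e < a * d"
  shows "asymptotically_stable (lorenz_type a b d e k m n) (0, 0, 0)"
proof -
  define w where "w = b * m / - n"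
  have w: "w > 0" "w * n = - (b * m)"
    using pos m n by (auto simp: w_def field_simps)
  define V :: "real \<times> real \<times> real \<Rightarrow> real" where "V = (\<lambda>(A, B, C). e * A^2 + b * B^2 + w * C^2)"
  define V' :: "real \<times> real \<times> real \<Rightarrow> real \<times> real \<times> real \<Rightarrow> real" where
    "V' = (\<lambda>(A, B, C) (u, v, r). 2 * e * A * u + 2 * b * B * v + 2 * w * C * r)"
  \<comment> \<open>Half the decay rate: replacing \<open>a\<close>, \<open>d\<close>, \<open>k\<close> by \<open>a - h\<close>, \<open>d - h\<close>, \<open>k - h\<close> must keep the form nonnegative, and
    \<open>(a - h) * (d - h) = a * d - h * (a + d) + h^2\<close>.\<close>
  define h where "h = min k ((a * d - b * e) / (a + d))"
  have h: "h > 0" "h \<le> k" "h * (a + d) \<le> a * d - b * e"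
  proof -
    show "h > 0" "h \<le> k" using pos det by (auto simp: h_def)
    have "h \<le> (a * d - b * e) / (a + d)" by (simp add: h_def)
    then show "h * (a + d) \<le> a * d - b * e" using pos by (simp add: pos_le_divide_eq)
  qed
  have "h * (a + d) < a * d" using h(3) pos by (smt (verit) mult_pos_pos)
  then have "h < a" "h < d"
    using pos h(1) by (smt (verit) mult_less_cancel_right mult_pos_pos distrib_left mult.commute)+
  have gap: "b * e \<le> (a - h) * (d - h)"
  proof -
    have "(a - h) * (d - h) = a * d - h * (a + d) + h^2"
      by (simp add: algebra_simps power2_eq_square)
    then show ?thesis using h(3) zero_le_power2[of h] by linarith
  qed
  have decay: "V' z (lorenz_type a b d e k m n z) \<le> - (2 * h) * V z" for z
  proof -
    obtain A B C where z: "z = (A, B, C)" by (cases z)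
    have "(b * e)^2 \<le> (b * e) * ((a - h) * (d - h))"
      using gap pos by (simp add: power2_eq_square)
    then have "0 \<le> (e * (a - h)) * A^2 - 2 * (b * e) * A * B + (b * (d - h)) * B^2"
      using pos \<open>h < a\<close> by (intro two_by_two_form_nonneg) (auto simp: mult_ac)
    moreover have "0 \<le> w * (k - h) * C^2"
      using w h by simp
    moreover have "V' z (lorenz_type a b d e k m n z) + 2 * h * V z =
      - 2 * ((e * (a - h)) * A^2 - 2 * (b * e) * A * B + (b * (d - h)) * B^2)
      - 2 * (w * (k - h) * C^2) + 2 * (b * m + w * n) * A * B * C"
      by (simp add: V'_def V_def z lorenz_type_def power2_eq_square algebra_simps)
    ultimately show ?thesis using w(2) by simp
  qed
  define q where "q = min e (min b w)"
  have q: "q > 0" "q \<le> e" "q \<le> b" "q \<le> w" using pos w by (auto simp: q_def)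
  show ?thesis
  proof (rule lyapunov_function_imp_asymptotically_stable)
    show "\<exists>L. L-lipschitz_on (cball (0, 0, 0) R) (lorenz_type a b d e k m n)" for R
      using lorenz_type_lipschitz_on by (simp add: zero_prod_def)
    show "(V has_derivative V' z) (at z)" for z
      unfolding V_def V'_def case_prod_unfold
      by (auto intro!: derivative_eq_intros simp: fun_eq_iff algebra_simps)
    show "V' z (lorenz_type a b d e k m n z) \<le> - (2 * h) * V z" for z by (rule decay)
    show "q * (dist z (0, 0, 0))^2 \<le> V z" for z
    proof -
      obtain A B C where z: "z = (A, B, C)" by (cases z)
      have "q * A^2 \<le> e * A^2" "q * B^2 \<le> b * B^2" "q * C^2 \<le> w * C^2"
        using q by (auto intro: mult_right_mono)
      then show ?thesis by (simp add: z V_def dist_norm norm_triple_power2 algebra_simps)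
    qed
  qed (use h q in \<open>auto simp: V_def\<close>)
qed

text \<open>
  With \<open>P = b B - a A\<close> and \<open>Q = e A - d B\<close>, the linear parts of the first two components, the form
  \<open>2 b e A B - a e A\<^sup>2 - b d B\<^sup>2\<close> has partial derivatives \<open>2 e P\<close> and \<open>2 b Q\<close>. Its derivative along the linear flow
  is therefore \<open>2 e P\<^sup>2 + 2 b Q\<^sup>2\<close>, which is positive definite because the block is invertible. It takes
  positive values, for instance at \<open>(b, a)\<close>, exactly when \<open>a d < b e\<close>. The nonlinear terms are
  absorbed by the definite part on a small ball.
\<close>

theorem lorenz_type_unstable:
  assumes pos: "a > 0" "b > 0" "d > 0" "e > 0" "k > 0" and det: "a * d < b * e"
  shows "unstable (lorenz_type a b d e k m n) (0, 0, 0)"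
proof -
  define V :: "real \<times> real \<times> real \<Rightarrow> real" where
    "V = (\<lambda>(A, B, C). 2 * (b * e) * A * B - a * e * A^2 - b * d * B^2 - C^2)"
  define V' :: "real \<times> real \<times> real \<Rightarrow> real \<times> real \<times> real \<Rightarrow> real" where
    "V' = (\<lambda>(A, B, C) (u, v, r).
      2 * e * (b * B - a * A) * u + 2 * b * (e * A - d * B) * v - 2 * C * r)"
  \<comment> \<open>The constants quantify invertibility: \<open>D * A\<close> and \<open>D * B\<close> are linear combinations of \<open>P\<close> and \<open>Q\<close>
    with coefficients \<open>d\<close>, \<open>b\<close> and \<open>e\<close>, \<open>a\<close>.\<close>
  define D where "D = b * e - a * d"
  define H where "H = 2 * (d^2 + e^2) / e + 2 * (a^2 + b^2) / b"
  define \<kappa> where "\<kappa> = D^2 / H"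
  have D: "D > 0" using det by (simp add: D_def)
  have H: "H > 0" using pos by (auto simp: H_def intro!: add_pos_pos divide_pos_pos)
  have \<kappa>: "\<kappa> > 0" using D H by (simp add: \<kappa>_def)
  have invertible: "\<kappa> * (A^2 + B^2) \<le> e * (b * B - a * A)^2 + b * (e * A - d * B)^2" for A B :: real
  proof -
    let ?P = "b * B - a * A" and ?Q = "e * A - d * B"
    have sq: "(x + y)^2 \<le> 2 * x^2 + 2 * y^2" for x y :: real
      using zero_le_power2[of "x - y"] by (simp add: power2_eq_square algebra_simps)
    have "D^2 * (A^2 + B^2) = (d * ?P + b * ?Q)^2 + (e * ?P + a * ?Q)^2"
      by (simp add: D_def power2_eq_square algebra_simps)
    also have "\<dots> \<le> (2 * (d * ?P)^2 + 2 * (b * ?Q)^2) + (2 * (e * ?P)^2 + 2 * (a * ?Q)^2)"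
      by (intro add_mono sq)
    also have "\<dots> = 2 * (d^2 + e^2) / e * (e * ?P^2) + 2 * (a^2 + b^2) / b * (b * ?Q^2)"
    proof -
      have "c / e * (e * x) = c * x" "c / b * (b * x) = c * x" for c x
        using pos by simp_all
      then show ?thesis by (simp only: power_mult_distrib) (simp add: algebra_simps)
    qed
    also have "\<dots> \<le> H * (e * ?P^2) + H * (b * ?Q^2)"
      using pos by (intro add_mono mult_right_mono) (auto simp: H_def)
    finally show ?thesis using H by (simp add: \<kappa>_def field_simps)
  qed
  \<comment> \<open>\<open>G\<close> collects the coefficients of the cubic terms; adding \<open>1\<close> keeps the divisor nonzero when \<open>m = n = 0\<close>.\<close>
  define G where "G = b * m^2 + \<bar>n\<bar> + 1"
  have G: "G \<ge> 1" using pos by (simp add: G_def)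
  define r where "r = min 1 (min (k / G) (\<kappa> / (2 * G)))"
  have r: "0 < r" "r \<le> 1" "G * r \<le> k" "G * r \<le> \<kappa> / 2"
    using pos G \<kappa> by (auto simp: r_def min_def field_simps)
  have small: "b * m^2 * r^2 + \<bar>n\<bar> * r \<le> k" "\<bar>n\<bar> * r \<le> \<kappa> / 2"
  proof -
    have "r^2 \<le> r" using r by (simp add: power2_eq_square mult_left_le)
    then have "b * m^2 * r^2 \<le> b * m^2 * r" using pos by (intro mult_left_mono) auto
    moreover have "b * m^2 * r \<ge> 0" using pos r by simp
    moreover have "G * r = b * m^2 * r + \<bar>n\<bar> * r + r" by (simp add: G_def algebra_simps)
    ultimately show "b * m^2 * r^2 + \<bar>n\<bar> * r \<le> k" "\<bar>n\<bar> * r \<le> \<kappa> / 2" using r by linarith+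
  qed
  have upper: "V (A, B, C) \<le> b * e * (A^2 + B^2)" for A B C :: real
  proof -
    have "0 \<le> b * e * (A - B)^2 + a * e * A^2 + b * d * B^2 + C^2" using pos by simp
    then show ?thesis by (simp add: V_def power2_eq_square algebra_simps)
  qed
  have inside: "\<bar>A\<bar> \<le> r" "\<bar>B\<bar> \<le> r" if "dist (A, B, C) (0, 0, 0) < r" for A B C :: real
    using that abs_le_norm_triple[where u = A and v = B and w = C] by (auto simp: dist_norm)
  show ?thesis
  proof (rule chetaev_function_imp_unstable[where V = V and V' = V'])
    show "(V has_derivative V' z) (at z)" for z
      unfolding V_def V'_def case_prod_unfold
      by (auto intro!: derivative_eq_intros simp: fun_eq_iff algebra_simps)
  next
    fix z :: "real \<times> real \<times> real" assume zr: "dist z (0, 0, 0) < r"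
    obtain A B C where z: "z = (A, B, C)" by (cases z)
    have Ar: "\<bar>A\<bar> \<le> r" and Br: "\<bar>B\<bar> \<le> r" using inside zr by (auto simp: z)
    have A2: "A^2 \<le> r^2" using power_mono[OF Ar, of 2] by simp
    have B2: "B^2 \<le> r^2" using power_mono[OF Br, of 2] by simp
    let ?P = "b * B - a * A" and ?Q = "e * A - d * B"
    have cubic1: "- (2 * b * m * ?Q * A * C) \<le> b * ?Q^2 + b * m^2 * r^2 * C^2"
    proof -
      have "0 \<le> b * (?Q + m * A * C)^2" using pos by simp
      then have "- (2 * b * m * ?Q * A * C) \<le> b * ?Q^2 + b * m^2 * A^2 * C^2"
        by (simp add: power2_eq_square algebra_simps)
      also have "b * m^2 * A^2 * C^2 \<le> b * m^2 * r^2 * C^2"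
        using pos A2 by (intro mult_right_mono mult_left_mono) auto
      finally show ?thesis by simp
    qed
    have cubic2: "2 * n * A * B * C \<le> \<bar>n\<bar> * r * (B^2 + C^2)"
    proof -
      have "2 * n * A * B * C \<le> \<bar>n\<bar> * \<bar>A\<bar> * (2 * \<bar>B\<bar> * \<bar>C\<bar>)"
        using abs_ge_self[of "2 * n * A * B * C"] by (simp add: abs_mult mult_ac)
      also have "\<dots> \<le> \<bar>n\<bar> * r * (B^2 + C^2)"
        using Ar r(1) sum_squares_bound[of "\<bar>B\<bar>" "\<bar>C\<bar>"] by (intro mult_mono) auto
      finally show ?thesis .
    qed
    \<comment> \<open>One half of \<open>2 * b * Q^2\<close> is spent on the first cubic term; the rest dominates \<open>\<kappa> * (A^2 + B^2)\<close>, of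
      which one half is spent on the second cubic term.\<close>
    have "\<kappa> / (2 * (b * e)) * V z \<le> \<kappa> / (2 * (b * e)) * (b * e * (A^2 + B^2))"
      using \<kappa> pos upper by (intro mult_left_mono) (auto simp: z)
    also have "\<dots> = \<kappa> / 2 * A^2 + \<kappa> / 2 * B^2"
      using pos by (simp add: field_simps)
    also have "\<dots> \<le> \<kappa> * (A^2 + B^2) - \<bar>n\<bar> * r * B^2 + (k - (b * m^2 * r^2 + \<bar>n\<bar> * r)) * C^2"
    proof -
      have "\<bar>n\<bar> * r * B^2 \<le> \<kappa> / 2 * B^2" using small(2) by (intro mult_right_mono) auto
      moreover have "0 \<le> (k - (b * m^2 * r^2 + \<bar>n\<bar> * r)) * C^2" using small(1) by simp
      moreover have "0 \<le> \<kappa> / 2 * A^2" using \<kappa> by simp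
      ultimately show ?thesis by (simp add: algebra_simps)
    qed
    also have "\<dots> \<le> e * ?P^2 + b * ?Q^2 - \<bar>n\<bar> * r * (B^2 + C^2) + (k - b * m^2 * r^2) * C^2"
      using invertible[of A B] by (simp add: algebra_simps)
    also have "\<dots> \<le> 2 * e * ?P^2 + 2 * b * ?Q^2 + 2 * b * m * ?Q * A * C + 2 * k * C^2 - 2 * n * A * B * C"
    proof -
      have "0 \<le> e * ?P^2" "0 \<le> k * C^2" using pos by auto
      moreover have "(k - b * m^2 * r^2) * C^2 = k * C^2 - b * m^2 * r^2 * C^2"
        by (simp add: algebra_simps)
      ultimately show ?thesis using cubic1 cubic2 by linarith
    qed
    also have "\<dots> = V' z (lorenz_type a b d e k m n z)"
      by (simp add: V'_def z lorenz_type_def power2_eq_square algebra_simps)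
    finally show "\<kappa> / (2 * (b * e)) * V z \<le> V' z (lorenz_type a b d e k m n z)" .
    have "V z \<le> b * e * (A^2 + B^2)" using upper by (simp add: z)
    also have "\<dots> \<le> b * e * (r^2 + r^2)" using pos A2 B2 by (intro mult_left_mono add_mono) auto
    finally show "V z \<le> b * e * (r^2 + r^2)" .
  next
    fix \<delta> :: real assume \<delta>: "\<delta> > 0"
    define s where "s = \<delta> / (2 * (a + b))"
    have s: "s > 0" using \<delta> pos by (simp add: s_def)
    have "norm (s * b, s * a, 0::real) \<le> s * (a + b)"
      using norm_triple_le[of "s * b" "s * a" 0] s pos by (simp add: algebra_simps)
    also have "s * (a + b) = \<delta> / 2" using pos by (simp add: s_def field_simps)
    also have "\<dots> < \<delta>" using \<delta> by simp
    finally have "dist (s * b, s * a, 0::real) (0, 0, 0) < \<delta>" by (simp add: dist_norm)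
    moreover have "V (s * b, s * a, 0) = s^2 * a * b * D"
      by (simp add: V_def D_def power2_eq_square algebra_simps)
    then have "V (s * b, s * a, 0) > 0" using s pos D by simp
    ultimately show "\<exists>z. dist z (0, 0, 0) < \<delta> \<and> V z > 0" by blast
  qed (use r \<kappa> pos in auto)
qed

section \<open>The critical Rayleigh number\<close>

text \<open>
  Apart from the factor \<open>(exp \<beta> - 1) / \<beta>\<close>, the critical value depends on \<open>\<beta>\<close> only through \<open>\<beta>\<^sup>2\<close>, so that
  factor alone produces the first-order term.
\<close>

lemma Ra_crit_expansion:
  assumes "l > 0"
  shows "(\<lambda>\<beta>. Ra_crit l \<gamma> \<beta> - Ra_crit_classical l * (1 + \<beta> / 2)) \<in> O[at_right 0](\<lambda>\<beta>. \<beta>^2)"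
proof -
  define G where "G h = l^2 / (h + 4 * pi^2) * ((pi^2 + 4 * pi^2 / l^2 + h / 4)^2
      + h * (4 * pi^2 / l^2) + \<gamma> * h * (4 * pi^2 / l^2)) * (pi^2 + 4 * pi^2 / l^2 - h / 4)" for h
  let ?E = "\<lambda>\<beta>::real. (exp \<beta> - 1) / \<beta>"
  have G0: "G 0 = Ra_crit_classical l"
    by (simp add: G_def Ra_crit_classical_def power2_eq_square power3_eq_cube)
  have "G field_differentiable at 0"
    unfolding G_def using assms by (auto intro!: derivative_intros)
  then obtain G' where G': "(G has_real_derivative G') (at 0)"
    unfolding field_differentiable_def by blast
  have deriv: "((\<lambda>h. (G h - G 0) / h) \<longlongrightarrow> G') (at 0)" and cont: "(G \<longlongrightarrow> G 0) (at 0)"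
    using G' DERIV_isCont[OF G'] by (simp_all add: has_field_derivative_iff isCont_def)
  have square: "filterlim (\<lambda>\<beta>::real. \<beta>^2) (at 0) (at_right 0)"
    by real_asymp
  have "((\<lambda>\<beta>. (G (\<beta>^2) - G 0) / \<beta>^2) \<longlongrightarrow> G') (at_right 0)"
    by (rule filterlim_compose[OF deriv square])
  then have even_part: "(\<lambda>\<beta>. G (\<beta>^2) - G 0) \<in> O[at_right 0](\<lambda>\<beta>. \<beta>^2)"
    by (rule bigoI_tendsto) (auto simp: eventually_at_filter)
  have "((\<lambda>\<beta>. G (\<beta>^2)) \<longlongrightarrow> G 0) (at_right 0)"
    by (rule filterlim_compose[OF cont square])
  then have G_bounded: "(\<lambda>\<beta>. G (\<beta>^2)) \<in> O[at_right 0](\<lambda>_. 1)"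
    by (intro bigoI_tendsto) auto
  have "(\<lambda>\<beta>. ?E \<beta> - (1 + \<beta> / 2)) \<in> O[at_right 0](\<lambda>\<beta>. \<beta>^2)"
    "(\<lambda>\<beta>. 1 + \<beta> / 2) \<in> O[at_right 0](\<lambda>_. 1::real)"
    by real_asymp+
  from landau_o.big.mult[OF G_bounded this(1)] landau_o.big.mult[OF even_part this(2)]
  have "(\<lambda>\<beta>. G (\<beta>^2) * (?E \<beta> - (1 + \<beta> / 2)) + (G (\<beta>^2) - G 0) * (1 + \<beta> / 2))
      \<in> O[at_right 0](\<lambda>\<beta>. \<beta>^2)"
    by (intro sum_in_bigo) auto
  also have "(\<lambda>\<beta>. G (\<beta>^2) * (?E \<beta> - (1 + \<beta> / 2)) + (G (\<beta>^2) - G 0) * (1 + \<beta> / 2))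
      = (\<lambda>\<beta>. G (\<beta>^2) * ?E \<beta> - G 0 * (1 + \<beta> / 2))"
    by (simp add: algebra_simps)
  also have "\<dots> = (\<lambda>\<beta>. Ra_crit l \<gamma> \<beta> - Ra_crit_classical l * (1 + \<beta> / 2))"
    unfolding G0 by (simp add: G_def Ra_crit_def mult_ac)
  finally show ?thesis .
qed

lemma Ra_crit_classical_pos: "l > 0 \<Longrightarrow> Ra_crit_classical l > 0"
  by (simp add: Ra_crit_classical_def add_pos_pos)

text \<open>
  With \<open>p = pi^2\<close> and \<open>s = 4 * p / l^2\<close> the classical value is \<open>(p + s)^3 / s\<close>, whose minimum lies at the double
  root \<open>s = p / 2\<close> of \<open>4 * (p + s)^3 - 27 * p^2 * s\<close>.
\<close>

lemma Ra_crit_classical_ge: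
  assumes l: "l > 0"
  shows "27 * pi^4 / 4 \<le> Ra_crit_classical l"
proof -
  define p where "p = pi^2"
  define s where "s = 4 * p / l^2"
  have p: "p > 0" by (simp add: p_def)
  have s: "s > 0" using l p by (simp add: s_def)
  have "0 \<le> (2 * s - p)^2 * (s + 4 * p)" using s p by simp
  also have "\<dots> = 4 * (p + s)^3 - 27 * p^2 * s"
    by (simp add: power2_eq_square power3_eq_cube algebra_simps)
  finally have "27 * p^2 / 4 \<le> (p + s)^3 / s" using s by (simp add: field_simps)
  also have "\<dots> = l^2 / (4 * p) * (p + s)^3"
    using l p by (simp add: s_def field_simps)
  finally show ?thesis by (simp add: Ra_crit_classical_def s_def p_def flip: power_mult)
qed

lemma eventually_Ra_crit_gt_classical:
  assumes "l > 0"
  shows "eventually (\<lambda>\<beta>. Ra_crit_classical l < Ra_crit l \<gamma> \<beta>) (at_right 0)"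
proof -
  let ?R = "Ra_crit_classical l"
  have R: "?R > 0" by (rule Ra_crit_classical_pos[OF assms])
  obtain K where K: "K > 0"
    "eventually (\<lambda>\<beta>. norm (Ra_crit l \<gamma> \<beta> - ?R * (1 + \<beta> / 2)) \<le> K * norm (\<beta>^2)) (at_right 0)"
    using Ra_crit_expansion[OF assms, of \<gamma>] by (elim landau_o.bigE)
  have "eventually (\<lambda>\<beta>::real. \<beta> \<in> {0<..<?R / (2 * K)}) (at_right 0)"
    using R K(1) by (intro eventually_at_right_real) auto
  with K(2) show ?thesis
  proof eventually_elim
    case (elim \<beta>)
    then have "K * \<beta> < ?R / 2" using K(1) by (simp add: field_simps)
    then have "K * \<beta> * \<beta> < ?R / 2 * \<beta>" using elim by (intro mult_strict_right_mono) auto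
    then show ?case using elim(1) by (simp add: power2_eq_square algebra_simps abs_le_iff)
  qed
qed

lemma lorenz_field_eq_lorenz_type:
  "lorenz_field l Pr \<gamma> \<beta> Ra =
    lorenz_type (- lorenz_e1 l Pr \<gamma> \<beta>) (lorenz_e2 l Pr \<beta> Ra) (- lorenz_e4 l \<beta>)
      (lorenz_e5 l \<beta> Ra) (- lorenz_e7 \<beta>) (lorenz_e3 l \<beta>) (lorenz_e6 l \<beta>)"
  by (auto simp: lorenz_field_def lorenz_type_def)

lemma lorenz_coefficient_signs:
  assumes "l > 0" "Pr > 0" "\<gamma> > 0" "Ra > 0" and \<beta>: "0 < \<beta>" "\<beta> < 1"
  shows "lorenz_e1 l Pr \<gamma> \<beta> < 0" "lorenz_e2 l Pr \<beta> Ra > 0" "lorenz_e3 l \<beta> > 0"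
    "lorenz_e4 l \<beta> < 0" "lorenz_e5 l \<beta> Ra > 0" "lorenz_e6 l \<beta> < 0" "lorenz_e7 \<beta> < 0"
proof -
  have pi2: "pi^2 > 1" using pi_gt3 by (simp add: one_less_power)
  have \<beta>2: "\<beta>^2 < 1" using \<beta> by (simp add: power_less_one_iff)
  have mu: "lorenz_mu l \<beta> > 0" using assms by (simp add: lorenz_mu_def add_pos_nonneg)
  have E: "(exp \<beta> - 1) / \<beta> > 0" "\<beta> / (1 - exp (- \<beta>)) > 0" using \<beta> by auto
  have N: "\<beta>^2 + c * pi^2 > 0" if "c > 0" for c using \<beta> that by (simp add: add_pos_nonneg)
  have ex: "1 + exp (- \<beta> / 2) > 0" by (simp add: add_pos_pos)
  have gap: "pi^2 + 4 * pi^2 / l^2 - \<beta>^2 / 4 > 0"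
  proof -
    have "0 \<le> 4 * pi^2 / l^2" by simp
    then show ?thesis using pi2 \<beta>2 by linarith
  qed
  show "lorenz_e1 l Pr \<gamma> \<beta> < 0"
  proof -
    have "0 < (lorenz_mu l \<beta>)^2 + \<beta>^2 * (4 * pi^2 / l^2) + \<gamma> * \<beta>^2 * (4 * pi^2 / l^2)"
      using mu assms by (intro add_pos_nonneg) auto
    then have "0 < (4 * pi^2 * Pr / (lorenz_mu l \<beta> * (\<beta>^2 + 4 * pi^2)))
      * ((lorenz_mu l \<beta>)^2 + \<beta>^2 * (4 * pi^2 / l^2) + \<gamma> * \<beta>^2 * (4 * pi^2 / l^2))
      * ((exp \<beta> - 1) / \<beta>)"
      using mu E N assms by (intro mult_pos_pos divide_pos_pos) auto
    then show ?thesis by (simp add: lorenz_e1_def)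
  qed
  show "lorenz_e2 l Pr \<beta> Ra > 0" using mu assms by (simp add: lorenz_e2_def)
  show "lorenz_e3 l \<beta> > 0" unfolding lorenz_e3_def
    using assms N ex by (intro mult_pos_pos divide_pos_pos) auto
  have "0 < ((\<beta>^2 + 4 * pi^2) / (4 * pi^2)) * (\<beta> / (1 - exp (- \<beta>)))
    * (pi^2 + 4 * pi^2 / l^2 - \<beta>^2 / 4)"
    using N E gap by (intro mult_pos_pos divide_pos_pos[OF N]) auto
  then show "lorenz_e4 l \<beta> < 0" by (simp add: lorenz_e4_def)
  show "lorenz_e5 l \<beta> Ra > 0" unfolding lorenz_e5_def
    using assms N E by (intro mult_pos_pos divide_pos_pos[OF N]) auto
  have "0 < sqrt (2 / l) * ((\<beta>^2 + 16 * pi^2) / (8 * l)) * (2 / (1 + exp (- \<beta> / 2)))"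
    using assms N ex by (intro mult_pos_pos divide_pos_pos[OF N] divide_pos_pos[OF _ ex]) auto
  moreover have "4 * \<beta>^2 / (\<beta>^2 + 16 * pi^2) - 3 * \<beta>^2 / (\<beta>^2 + 64 * pi^2) - 1 < 0"
  proof -
    have "4 * \<beta>^2 / (\<beta>^2 + 16 * pi^2) < 1" using \<beta>2 pi2 N[of 16] by (simp add: divide_less_eq)
    moreover have "3 * \<beta>^2 / (\<beta>^2 + 64 * pi^2) \<ge> 0" using N[of 64] by simp
    ultimately show ?thesis by linarith
  qed
  ultimately show "lorenz_e6 l \<beta> < 0" unfolding lorenz_e6_def by (rule mult_pos_neg)
  have "\<beta>^2 / 8 - 2 * pi^2 < 0" using \<beta>2 pi2 by simp
  then show "lorenz_e7 \<beta> < 0" unfolding lorenz_e7_def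
    using E N by (intro mult_pos_neg mult_pos_pos divide_pos_pos[OF N]) auto
qed

text \<open>
  The factor \<open>(\<beta>^2 + 4 * pi^2) / (4 * pi^2)\<close> of \<open>e4\<close> cancels against \<open>e1\<close>, and \<open>e2\<close> and \<open>e5\<close> contribute one square
  root of \<open>Ra\<close> each. The determinant is thus affine in \<open>Ra\<close>, and \<open>Ra_crit\<close> is its zero.
\<close>

lemma lorenz_determinant:
  assumes "l > 0" "Ra > 0" "\<beta> > 0"
  shows "lorenz_e1 l Pr \<gamma> \<beta> * lorenz_e4 l \<beta> - lorenz_e2 l Pr \<beta> Ra * lorenz_e5 l \<beta> Ra =
    Pr * (\<beta>^2 + 4 * pi^2) / (lorenz_mu l \<beta> * l^2) * (\<beta> / (1 - exp (- \<beta>))) * (Ra_crit l \<gamma> \<beta> - Ra)"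
proof -
  define M where "M = lorenz_mu l \<beta>"
  define N where "N = \<beta>^2 + 4 * pi^2"
  define E where "E = (exp \<beta> - 1) / \<beta>"
  define F where "F = \<beta> / (1 - exp (- \<beta>))"
  define Q where "Q = M^2 + \<beta>^2 * (4 * pi^2 / l^2) + \<gamma> * \<beta>^2 * (4 * pi^2 / l^2)"
  define S where "S = pi^2 + 4 * pi^2 / l^2 - \<beta>^2 / 4"
  have MN: "M > 0" "N > 0"
    using assms by (auto simp: M_def N_def lorenz_mu_def add_pos_pos add_pos_nonneg)
  have e1: "lorenz_e1 l Pr \<gamma> \<beta> = - (4 * pi^2 * Pr / (M * N)) * Q * E"
    by (simp add: lorenz_e1_def M_def N_def Q_def E_def)
  have e4: "lorenz_e4 l \<beta> = - (N / (4 * pi^2)) * F * S"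
    by (simp add: lorenz_e4_def N_def F_def S_def)
  have e25: "lorenz_e2 l Pr \<beta> Ra * lorenz_e5 l \<beta> Ra = Ra * Pr * N / (M * l^2) * F"
  proof -
    have "(x * r / y) * (r * z * v) = (r * r) * ((x / y) * z * v)" for x r y z v :: real
      by (simp add: mult_ac)
    then have "lorenz_e2 l Pr \<beta> Ra * lorenz_e5 l \<beta> Ra
        = (sqrt Ra * sqrt Ra) * ((2 * pi * Pr / (M * l)) * (N / (2 * pi * l)) * F)"
      unfolding lorenz_e2_def lorenz_e5_def M_def N_def F_def .
    also have "\<dots> = Ra * Pr * N / (M * l^2) * F"
      using assms MN by (simp add: field_simps power2_eq_square)
    finally show ?thesis .
  qed
  have Ra_crit: "Ra_crit l \<gamma> \<beta> = l^2 / N * E * Q * S"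
    by (simp add: Ra_crit_def N_def E_def Q_def S_def M_def lorenz_mu_def)
  have "lorenz_e1 l Pr \<gamma> \<beta> * lorenz_e4 l \<beta> = Pr * N / (M * l^2) * F * (l^2 / N * E * Q * S)"
    unfolding e1 e4 using assms MN by (simp add: field_simps)
  then show ?thesis
    unfolding M_def[symmetric] N_def[symmetric] F_def[symmetric] e25 Ra_crit
    by (simp add: algebra_simps)
qed

lemma lorenz_stability_threshold:
  assumes "l > 0" "Pr > 0" "\<gamma> > 0" "Ra > 0" and \<beta>: "0 < \<beta>" "\<beta> < 1"
  shows "Ra < Ra_crit l \<gamma> \<beta> \<Longrightarrow> asymptotically_stable (lorenz_field l Pr \<gamma> \<beta> Ra) (0, 0, 0)"
    and "Ra > Ra_crit l \<gamma> \<beta> \<Longrightarrow> unstable (lorenz_field l Pr \<gamma> \<beta> Ra) (0, 0, 0)"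
proof -
  note signs = lorenz_coefficient_signs[OF assms]
  let ?c = "Pr * (\<beta>^2 + 4 * pi^2) / (lorenz_mu l \<beta> * l^2) * (\<beta> / (1 - exp (- \<beta>)))"
  have "lorenz_mu l \<beta> > 0" using assms by (simp add: lorenz_mu_def add_pos_nonneg)
  then have c: "?c > 0"
    using assms by (intro mult_pos_pos divide_pos_pos) (auto simp: add_pos_pos)
  have det: "lorenz_e1 l Pr \<gamma> \<beta> * lorenz_e4 l \<beta> - lorenz_e2 l Pr \<beta> Ra * lorenz_e5 l \<beta> Ra
      = ?c * (Ra_crit l \<gamma> \<beta> - Ra)"
    by (rule lorenz_determinant) (use assms in auto)
  show "asymptotically_stable (lorenz_field l Pr \<gamma> \<beta> Ra) (0, 0, 0)" if "Ra < Ra_crit l \<gamma> \<beta>"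
  proof -
    have "0 < ?c * (Ra_crit l \<gamma> \<beta> - Ra)" by (rule mult_pos_pos[OF c]) (use that in simp)
    then show ?thesis unfolding lorenz_field_eq_lorenz_type
      using signs det by (intro lorenz_type_asymptotically_stable) auto
  qed
  show "unstable (lorenz_field l Pr \<gamma> \<beta> Ra) (0, 0, 0)" if "Ra > Ra_crit l \<gamma> \<beta>"
  proof -
    have "?c * (Ra_crit l \<gamma> \<beta> - Ra) < 0" by (rule mult_pos_neg[OF c]) (use that in simp)
    then show ?thesis unfolding lorenz_field_eq_lorenz_type
      using signs det by (intro lorenz_type_unstable) auto
  qed
qed

theorem mainTheorem2:
  fixes l Pr \<gamma> :: real
  assumes "l > 0" and "Pr > 0" and "\<gamma> > 0"
  shows "(\<exists>\<beta>0>0. \<forall>\<beta>\<in>{0<..<\<beta>0}.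
      (\<forall>Ra>0.
        (Ra < Ra_crit l \<gamma> \<beta> \<longrightarrow> asymptotically_stable (lorenz_field l Pr \<gamma> \<beta> Ra) (0, 0, 0)) \<and>
        (Ra > Ra_crit l \<gamma> \<beta> \<longrightarrow> unstable (lorenz_field l Pr \<gamma> \<beta> Ra) (0, 0, 0))) \<and>
      Ra_crit l \<gamma> \<beta> > Ra_crit_classical l \<and>
      Ra_crit l \<gamma> \<beta> > 27 * pi^4 / 4) \<and>
    (\<lambda>\<beta>. Ra_crit l \<gamma> \<beta> - Ra_crit_classical l * (1 + \<beta> / 2)) \<in> O[at_right 0](\<lambda>\<beta>. \<beta>^2)"
proof
  obtain b where b: "b > 0" "\<And>\<beta>. 0 < \<beta> \<Longrightarrow> \<beta> < b \<Longrightarrow> Ra_crit_classical l < Ra_crit l \<gamma> \<beta>"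
    using eventually_Ra_crit_gt_classical[OF assms(1)] unfolding eventually_at_right_field by auto
  show "\<exists>\<beta>0>0. \<forall>\<beta>\<in>{0<..<\<beta>0}.
      (\<forall>Ra>0.
        (Ra < Ra_crit l \<gamma> \<beta> \<longrightarrow> asymptotically_stable (lorenz_field l Pr \<gamma> \<beta> Ra) (0, 0, 0)) \<and>
        (Ra > Ra_crit l \<gamma> \<beta> \<longrightarrow> unstable (lorenz_field l Pr \<gamma> \<beta> Ra) (0, 0, 0))) \<and>
      Ra_crit l \<gamma> \<beta> > Ra_crit_classical l \<and>
      Ra_crit l \<gamma> \<beta> > 27 * pi^4 / 4"
  proof (intro exI[of _ "min 1 b"] conjI ballI)
    fix \<beta> assume \<beta>: "\<beta> \<in> {0<..<min 1 b}"
    then show "\<forall>Ra>0.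
        (Ra < Ra_crit l \<gamma> \<beta> \<longrightarrow> asymptotically_stable (lorenz_field l Pr \<gamma> \<beta> Ra) (0, 0, 0)) \<and>
        (Ra > Ra_crit l \<gamma> \<beta> \<longrightarrow> unstable (lorenz_field l Pr \<gamma> \<beta> Ra) (0, 0, 0))"
      using lorenz_stability_threshold[OF assms] by auto
    show gt: "Ra_crit l \<gamma> \<beta> > Ra_crit_classical l" using \<beta> b by auto
    show "Ra_crit l \<gamma> \<beta> > 27 * pi^4 / 4"
      using Ra_crit_classical_ge[OF assms(1)] gt by linarith
  qed (use b in auto)
  show "(\<lambda>\<beta>. Ra_crit l \<gamma> \<beta> - Ra_crit_classical l * (1 + \<beta> / 2)) \<in> O[at_right 0](\<lambda>\<beta>. \<beta>^2)"
    by (rule Ra_crit_expansion[OF assms(1)])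
qed

end
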